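(* For every large walled wedge there exists a finite deterministic automaton that explores it using one pebble.
   Context: The oriented grid $\mathbb{Z}\times\mathbb{Z}$ is embedded in the plane (nodes at integer points, edges between nodes at distance 1); nodes are anonymous and every node has ports $N,E,S,W$ pointing North, East, South, West. Given two half-lines $H_1,H_2$ in the plane with a common origin $O$ (an arbitrary point; arbitrary real directions), let $W(H_1,H_2)$ be the closed region swept clockwise from $H_1$ to $H_2$ (half-lines included); the wedge is the subgraph of the grid induced by the grid nodes in $W(H_1,H_2)$. It is large if the clockwise angle $\alpha$ from $H_1$ to $H_2$ satisfies $\pi\le\alpha\le 2\pi$. A boundary $H_i$ is a wall if for every grid edge $\{u,v\}$ with $u$ in the wedge, $v$ not in the wedge and $H_i$ meeting the closed segment $[u,v]$, the ports of this edge at $u$ and at $v$ are blocked (cannot be taken); all other ports are free. A wedge is walled if both boundaries are walls. The agent is a finite deterministic (Mealy) automaton carrying $p$ pebbles: at each step it sees which ports at the current node are free, whether a pebble lies there, and how many pebbles it carries; depending on its state and this input it moves through a free port, possibly dropping a pebble on the empty current node (if it carries one) or picking up the pebble lying there, and changes state. It starts in its initial state with all $p$ pebbles, no pebbles on the grid, at an adversarially chosen node of the wedge. The automaton (which may depend on $H_1,H_2$ but not on the starting node) explores the wedge if for every starting node every node of the wedge is eventually visited.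
   Formalization: The clockwise angle is taken in [0,2π), so the full turn α=2π (coinciding half-lines, wedge equal to the whole grid) is excluded; there no edge leaves the wedge, no port is blocked, and one pebble does not suffice. *)

theory Defs
  imports "HOL-Analysis.Analysis" "HOL-Library.Real_Mod"
begin

datatype port = North | East | South | West

type_synonym node = "int \<times> int"

fun neighbour :: "node \<Rightarrow> port \<Rightarrow> node" where
  "neighbour (x, y) North = (x, y + 1)"
| "neighbour (x, y) East = (x + 1, y)"
| "neighbour (x, y) South = (x, y - 1)"
| "neighbour (x, y) West = (x - 1, y)"

text \<open>The plane is modelled by the complex numbers.\<close>

definition point :: "node \<Rightarrow> complex" where
  "point u = Complex (of_int (fst u)) (of_int (snd u))"

definition half_line :: "complex \<Rightarrow> real \<Rightarrow> complex set" where
  "half_line c \<theta> = {c + of_real r * cis \<theta> | r. 0 \<le> r}"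

text \<open>
  The clockwise angle from the half-line of direction \<open>\<theta>1\<close> to the one of direction \<open>\<theta>2\<close> is the
  least non-negative clockwise rotation carrying the first onto the second, a value in
  \<open>[0, 2\<pi>)\<close> that depends only on the two half-lines. In particular it is \<open>0\<close> when the half-lines
  coincide: the full turn \<open>2\<pi>\<close>, for which the swept region would be the whole plane, no edge would
  leave the wedge and so no port would be blocked, is not attained.
\<close>

definition clockwise_angle :: "real \<Rightarrow> real \<Rightarrow> real" where
  "clockwise_angle \<theta>1 \<theta>2 = (\<theta>1 - \<theta>2) rmod (2 * pi)"

definition swept_region :: "complex \<Rightarrow> real \<Rightarrow> real \<Rightarrow> complex set" where
  "swept_region c \<theta>1 \<theta>2 = (\<Union>\<phi>\<in>{0..clockwise_angle \<theta>1 \<theta>2}. half_line c (\<theta>1 - \<phi>))"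

definition wedge :: "complex \<Rightarrow> real \<Rightarrow> real \<Rightarrow> node set" where
  "wedge c \<theta>1 \<theta>2 = {u. point u \<in> swept_region c \<theta>1 \<theta>2}"

definition large_wedge :: "real \<Rightarrow> real \<Rightarrow> bool" where
  "large_wedge \<theta>1 \<theta>2 \<longleftrightarrow> pi \<le> clockwise_angle \<theta>1 \<theta>2 \<and> clockwise_angle \<theta>1 \<theta>2 \<le> 2 * pi"

text \<open>
  Ports blocked when \<open>V\<close> is the set of nodes of the wedge and \<open>Hs\<close> is the set of those
  boundaries that are walls. An edge leaving \<open>V\<close> through a wall is blocked at both ends.
\<close>

definition blocked_ports :: "node set \<Rightarrow> complex set set \<Rightarrow> node \<Rightarrow> port set" where
  "blocked_ports V Hs u =
     {d. let v = neighbour u d in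
         (u \<in> V \<longleftrightarrow> v \<notin> V) \<and> (\<exists>H\<in>Hs. H \<inter> closed_segment (point u) (point v) \<noteq> {})}"

definition walled_wedge_blocked_ports :: "complex \<Rightarrow> real \<Rightarrow> real \<Rightarrow> node \<Rightarrow> port set" where
  "walled_wedge_blocked_ports c \<theta>1 \<theta>2 =
     blocked_ports (wedge c \<theta>1 \<theta>2) {half_line c \<theta>1, half_line c \<theta>2}"

text \<open>
  An observation consists of the free ports at the current node, whether a pebble lies there, and
  the number of carried pebbles.
\<close>

type_synonym observation = "port set \<times> bool \<times> nat"

datatype pebble_action = Keep | Drop | Pick

record 's automaton =
  states :: "'s set"
  initial :: 's
  trans :: "'s \<Rightarrow> observation \<Rightarrow> 's \<times> port \<times> pebble_action"

text \<open>
  A node without free ports offers no move, so nothing is required of \<open>trans\<close> there; in \<open>step\<close> the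
  agent is then stuck.
\<close>

definition pebble_automaton :: "nat \<Rightarrow> 's automaton \<Rightarrow> bool" where
  "pebble_automaton p A \<longleftrightarrow>
     finite (states A) \<and> initial A \<in> states A \<and>
     (\<forall>s\<in>states A. \<forall>F b k. F \<noteq> {} \<and> k \<le> p \<longrightarrow>
        (case trans A s (F, b, k) of (s', d, a) \<Rightarrow>
           s' \<in> states A \<and> d \<in> F \<and>
           (a = Drop \<longrightarrow> \<not> b \<and> 0 < k) \<and> (a = Pick \<longrightarrow> b)))"

record 's config =
  state :: 's
  position :: node
  pebbles :: "node set"
  carried :: nat

definition initial_config :: "nat \<Rightarrow> 's automaton \<Rightarrow> node \<Rightarrow> 's config" where
  "initial_config p A u = \<lparr>state = initial A, position = u, pebbles = {}, carried = p\<rparr>"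

definition step :: "(node \<Rightarrow> port set) \<Rightarrow> 's automaton \<Rightarrow> 's config \<Rightarrow> 's config" where
  "step B A C =
     (let u = position C; F = - B u in
      if F = {} then C
      else case trans A (state C) (F, u \<in> pebbles C, carried C) of (s', d, a) \<Rightarrow>
        \<lparr>state = s', position = neighbour u d,
         pebbles = (case a of Keep \<Rightarrow> pebbles C
                            | Drop \<Rightarrow> insert u (pebbles C)
                            | Pick \<Rightarrow> pebbles C - {u}),
         carried = (case a of Keep \<Rightarrow> carried C
                            | Drop \<Rightarrow> carried C - 1
                            | Pick \<Rightarrow> carried C + 1)\<rparr>)"

definition explores :: "nat \<Rightarrow> 's automaton \<Rightarrow> (node \<Rightarrow> port set) \<Rightarrow> node set \<Rightarrow> bool" where
  "explores p A B V \<longleftrightarrow>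
     (\<forall>u\<in>V. \<forall>v\<in>V. \<exists>n. position ((step B A ^^ n) (initial_config p A u)) = v)"

end

theory Submission
  imports Defs
begin

text \<open>
  A wedge of angle at least \<open>\<pi>\<close> is a union of two half-planes, and the rest of the plane is an
  open convex cone \<open>K\<close>. Choose lattice vectors \<open>d\<close>, \<open>v = k d + a\<close>, \<open>v' = k d - a\<close> inside \<open>K\<close>, where
  \<open>d\<close>, \<open>a\<close> is a lattice basis. The agent advances by \<open>d\<close> until it is stopped at a node \<open>P\<close> with
  \<open>P + d\<close> in \<open>K\<close>. Then it repeats forever: drop the pebble, advance by \<open>v\<close> until stopped by the
  wall, retreat by \<open>- v\<close> to the pebble, do the same with \<open>v'\<close>, and carry the pebble along by \<open>- d\<close>.
  Since \<open>v\<close> points into \<open>K\<close>, each trip ends. Every lattice point that is not of the form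
  \<open>P - t d + s v\<close> or \<open>P - t d + s v'\<close> with \<open>s, t \<ge> 0\<close> is obtained from \<open>P + d\<close> by adding vectors of
  \<open>K\<close>, so it lies outside the wedge.

  A single advance by a vector \<open>w\<close> of \<open>K\<close> follows a lattice word that goes away from the boundary
  line of one half-plane before approaching it, so it succeeds if the target lies in that
  half-plane; if it is blocked, the agent backtracks and tries the word for the other one.
\<close>

fun opposite :: "port \<Rightarrow> port" where
  "opposite North = South"
| "opposite East = West"
| "opposite South = North"
| "opposite West = East"

lemma neighbour_opposite [simp]: "neighbour (neighbour u d) (opposite d) = u"
  by (cases u; cases d) auto

subsection \<open>Programs for the agent\<close>

datatype instr =
    Walk "port list" nat nat
  | Branch nat nat
  | Put nat
  | Take nat

text \<open>
  \<open>Walk w l l'\<close> continues at line \<open>l\<close> after completing \<open>w\<close>; if a port on the way is blocked, the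
  agent backtracks to where it started and continues at \<open>l'\<close>. In a state \<open>(l, n, b)\<close>, \<open>n\<close> letters
  of the word on line \<open>l\<close> separate the agent from the start of the walk, and \<open>b\<close> tells whether it
  is advancing. The result \<open>None\<close> for the port means that the agent should not move.
\<close>

fun exec :: "instr \<Rightarrow> nat \<times> nat \<times> bool \<Rightarrow> observation \<Rightarrow>
    (nat \<times> nat \<times> bool) \<times> port option \<times> pebble_action" where
  "exec (Walk w s f) (l, n, b) (F, peb, k) =
     (if b then
        if n < length w then
          if w ! n \<in> F then ((l, Suc n, True), Some (w ! n), Keep)
          else ((l, n, False), None, Keep)
        else ((s, 0, True), None, Keep)
      else if n = 0 then ((f, 0, True), None, Keep)
      else ((l, n - 1, False), Some (opposite (w ! (n - 1))), Keep))"
| "exec (Branch s f) (l, n, b) (F, peb, k) = ((if peb then s else f, 0, True), None, Keep)"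
| "exec (Put s) (l, n, b) (F, peb, k) =
     ((s, 0, True), None, if \<not> peb \<and> 0 < k then Drop else Keep)"
| "exec (Take s) (l, n, b) (F, peb, k) = ((s, 0, True), None, if peb then Pick else Keep)"

text \<open>
  An agent has to move at every step, so resting is simulated by a step through an arbitrary free
  port; the way back is remembered in the last component of the state.
\<close>

type_synonym control = "(nat \<times> nat \<times> bool) \<times> port option"

text \<open>The fallback keeps the automaton legal on observations in which the wanted port is
  blocked, since \<open>pebble_automaton\<close> quantifies over all observations.\<close>

definition free_or :: "port \<Rightarrow> port set \<Rightarrow> port" where
  "free_or d F = (if d \<in> F then d else SOME d. d \<in> F)"

fun run :: "instr list \<Rightarrow> control \<Rightarrow> observation \<Rightarrow> control \<times> port \<times> pebble_action" where
  "run prog (s, Some d) (F, obs) = ((s, None), free_or d F, Keep)"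
| "run prog (s, None) (F, obs) =
     (case exec (prog ! fst s) s (F, obs) of
        (s', Some d, a) \<Rightarrow> ((s', None), free_or d F, a)
      | (s', None, a) \<Rightarrow> let d = SOME d. d \<in> F in ((s', Some (opposite d)), d, a))"

fun targets :: "instr \<Rightarrow> nat set" where
  "targets (Walk w s f) = {s, f}"
| "targets (Branch s f) = {s, f}"
| "targets (Put s) = {s}"
| "targets (Take s) = {s}"

fun instr_size :: "instr \<Rightarrow> nat" where
  "instr_size (Walk w s f) = length w"
| "instr_size _ = 0"

text \<open>The sum of all word lengths bounds the letter counter on every line at once, so the
  state set is finite.\<close>

definition program_automaton :: "instr list \<Rightarrow> control automaton" where
  "program_automaton prog =
     \<lparr>states = ({..<length prog} \<times> {..sum_list (map instr_size prog)} \<times> UNIV) \<times> UNIV,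
      initial = ((0, 0, True), None),
      trans = run prog\<rparr>"

lemma UNIV_port: "UNIV = {North, East, South, West}"
  using port.exhaust by auto

lemma finite_port: "finite (UNIV :: port set)"
  by (simp add: UNIV_port)

lemma finite_port_option: "finite (UNIV :: port option set)"
  using finite_port by (simp add: UNIV_option_conv)

lemma exec_state:
  assumes "exec i (l, n, b) obs = ((l', n', b'), d, a)" "n \<le> N" "instr_size i \<le> N"
  shows "l' \<in> insert l (targets i)" "n' \<le> N"
  using assms by (cases i; cases obs; auto split: if_splits)+

lemma exec_action:
  assumes "exec i s (F, peb, k) = (s', d, a)"
  shows "a = Drop \<Longrightarrow> \<not> peb \<and> 0 < k" "a = Pick \<Longrightarrow> peb"
  using assms by (cases i; cases s; auto split: if_splits)+

lemma free_or_in: "F \<noteq> {} \<Longrightarrow> free_or d F \<in> F"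
  by (simp add: free_or_def some_in_eq)

lemma pebble_automaton_program:
  assumes "prog \<noteq> []" and tgt: "\<forall>i\<in>set prog. targets i \<subseteq> {..<length prog}"
  shows "pebble_automaton p (program_automaton prog)"
proof -
  let ?N = "sum_list (map instr_size prog)"
  have main: "case run prog s (F, b, k) of (s', d, a) \<Rightarrow>
           s' \<in> states (program_automaton prog) \<and> d \<in> F \<and>
           (a = Drop \<longrightarrow> \<not> b \<and> 0 < k) \<and> (a = Pick \<longrightarrow> b)"
    if s: "s \<in> states (program_automaton prog)" and F: "F \<noteq> {}" for s F b k
  proof -
    obtain l n c r where sdef: "s = ((l, n, c), r)"
      by (metis surj_pair)
    have l: "l < length prog" and n: "n \<le> ?N"
      using s by (auto simp: program_automaton_def sdef)
    show ?thesis
    proof (cases r)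
      case (Some d)
      then show ?thesis
        using l n free_or_in[OF F] by (simp add: sdef program_automaton_def)
    next
      case None
      obtain l' n' c' d a where e: "exec (prog ! l) (l, n, c) (F, b, k) = ((l', n', c'), d, a)"
        by (metis surj_pair)
      have "instr_size (prog ! l) \<le> ?N"
        using l by (intro member_le_sum_list) auto
      with exec_state[OF e n] have "l' \<in> insert l (targets (prog ! l))" "n' \<le> ?N"
        by auto
      moreover have "targets (prog ! l) \<subseteq> {..<length prog}"
        using tgt l by auto
      ultimately have "l' < length prog" "n' \<le> ?N"
        using l by auto
      moreover have "(SOME d. d \<in> F) \<in> F"
        using F by (simp add: some_in_eq)
      ultimately show ?thesis
        using exec_action[OF e] free_or_in[OF F] e
        by (auto simp: sdef None program_automaton_def Let_def split: option.split)
    qed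
  qed
  have "finite (states (program_automaton prog))"
    using finite_port_option by (simp add: program_automaton_def finite_cartesian_product)
  moreover have "trans (program_automaton prog) = run prog"
    and "initial (program_automaton prog) \<in> states (program_automaton prog)"
    using assms(1) by (auto simp: program_automaton_def)
  ultimately show ?thesis
    unfolding pebble_automaton_def using main by auto
qed

subsection \<open>Renaming states\<close>

instance port :: countable
  by countable_datatype

text \<open>The final theorem asks for states of type \<open>nat\<close>. As \<open>from_nat\<close>
  is a left inverse of \<open>to_nat\<close>, both automata run in step.\<close>

definition encode :: "'s::countable automaton \<Rightarrow> nat automaton" where
  "encode A = \<lparr>states = to_nat ` states A, initial = to_nat (initial A),
     trans = (\<lambda>n obs. map_prod to_nat id (trans A (from_nat n) obs))\<rparr>"

definition encode_config :: "'s::countable config \<Rightarrow> nat config" where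
  "encode_config C = \<lparr>state = to_nat (state C), position = position C,
     pebbles = pebbles C, carried = carried C\<rparr>"

lemma pebble_automaton_encode:
  assumes "pebble_automaton p A"
  shows "pebble_automaton p (encode A)"
proof -
  note A = assms[unfolded pebble_automaton_def, THEN conjunct1]
    assms[unfolded pebble_automaton_def, THEN conjunct2, THEN conjunct1]
    assms[unfolded pebble_automaton_def, THEN conjunct2, THEN conjunct2]
  have "case trans (encode A) (to_nat s) (F, b, k) of (s', d, a) \<Rightarrow>
      s' \<in> states (encode A) \<and> d \<in> F \<and> (a = Drop \<longrightarrow> \<not> b \<and> 0 < k) \<and> (a = Pick \<longrightarrow> b)"
    if "s \<in> states A" "F \<noteq> {}" "k \<le> p" for s F b k
    using A(3)[THEN bspec, OF that(1), THEN spec[of _ F], THEN spec[of _ b], THEN spec[of _ k],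
        THEN mp, OF conjI, OF that(2,3)]
    by (cases "trans A s (F, b, k)") (simp add: encode_def)
  moreover have "states (encode A) = to_nat ` states A" "initial (encode A) = to_nat (initial A)"
    by (simp_all add: encode_def)
  ultimately show ?thesis
    using A(1,2) unfolding pebble_automaton_def by (simp only: ball_simps) simp
qed

lemma step_encode: "step B (encode A) (encode_config C) = encode_config (step B A C)"
  by (simp add: step_def encode_def encode_config_def Let_def
      split: prod.split pebble_action.split)

lemma explores_encode:
  assumes "explores p A B V"
  shows "explores p (encode A) B V"
proof -
  have "(step B (encode A) ^^ n) (encode_config C) = encode_config ((step B A ^^ n) C)" for n C
    by (induction n) (auto simp: step_encode)
  moreover have "initial_config p (encode A) u = encode_config (initial_config p A u)" for u
    by (simp add: initial_config_def encode_def encode_config_def)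
  ultimately show ?thesis
    using assms by (simp add: explores_def encode_config_def)
qed

subsection \<open>Running a program\<close>

definition reaches ::
    "(node \<Rightarrow> port set) \<Rightarrow> 's automaton \<Rightarrow> 's config \<Rightarrow> 's config \<Rightarrow> bool" where
  "reaches B A C C' \<longleftrightarrow> (\<exists>n. (step B A ^^ n) C = C')"

lemma reaches_refl: "reaches B A C C"
  unfolding reaches_def by (rule exI[of _ 0]) simp

lemma reaches_trans [trans]: "reaches B A C C' \<Longrightarrow> reaches B A C' C'' \<Longrightarrow> reaches B A C C''"
proof -
  assume "reaches B A C C'" "reaches B A C' C''"
  then obtain m n where "(step B A ^^ m) C = C'" "(step B A ^^ n) C' = C''"
    by (auto simp: reaches_def)
  hence "(step B A ^^ (n + m)) C = C''"
    by (simp add: funpow_add)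
  thus ?thesis
    unfolding reaches_def ..
qed

lemma reaches_step: "step B A C = C' \<Longrightarrow> reaches B A C C'"
  unfolding reaches_def by (rule exI[of _ 1]) simp

definition stays_in :: "node set \<Rightarrow> node \<Rightarrow> port list \<Rightarrow> bool" where
  "stays_in V u w \<longleftrightarrow> (\<forall>n\<le>length w. foldl neighbour u (take n w) \<in> V)"

text \<open>Blocking every edge between \<open>V\<close> and its complement confines the agent to
  \<open>V\<close>; a neighbour inside \<open>V\<close> provides the free port needed to simulate
  rest.\<close>

locale walled_region =
  fixes V :: "node set" and B :: "node \<Rightarrow> port set" and prog :: "instr list"
  assumes blocked: "B u = {d. u \<in> V \<longleftrightarrow> neighbour u d \<notin> V}"
    and not_isolated: "u \<in> V \<Longrightarrow> \<exists>d. neighbour u d \<in> V"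
begin

abbreviation leads_to (infix "\<leadsto>" 50) where
  "C \<leadsto> C' \<equiv> reaches B (program_automaton prog) C C'"

definition config_in :: "nat \<times> nat \<times> bool \<Rightarrow> node \<Rightarrow> node set \<Rightarrow> nat \<Rightarrow> control config" where
  "config_in s u ps k = \<lparr>state = (s, None), position = u, pebbles = ps, carried = k\<rparr>"

abbreviation at_line :: "nat \<Rightarrow> node \<Rightarrow> node set \<Rightarrow> nat \<Rightarrow> control config" where
  "at_line l \<equiv> config_in (l, 0, True)"

lemma free_iff: "u \<in> V \<Longrightarrow> d \<notin> B u \<longleftrightarrow> neighbour u d \<in> V"
  by (auto simp: blocked)

lemma exec_move:
  assumes e: "exec (prog ! fst s) s (- B u, u \<in> ps, k) = (s', Some d, Keep)"
    and u: "u \<in> V" "neighbour u d \<in> V"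
  shows "config_in s u ps k \<leadsto> config_in s' (neighbour u d) ps k"
proof (rule reaches_step)
  have d: "d \<in> - B u"
    using u by (simp add: free_iff)
  hence "- B u \<noteq> {}"
    by blast
  with d e show "step B (program_automaton prog) (config_in s u ps k) =
      config_in s' (neighbour u d) ps k"
    by (simp add: step_def config_in_def program_automaton_def Let_def free_or_def)
qed

text \<open>Rest costs two moves. The pebble action happens on leaving \<open>u\<close>, and an edge
  is blocked at both ends or at neither, so the way back is free.\<close>

lemma exec_rest:
  assumes e: "exec (prog ! fst s) s (- B u, u \<in> ps, k) = (s', None, a)" and u: "u \<in> V"
  shows "config_in s u ps k \<leadsto> config_in s' u
      (case a of Keep \<Rightarrow> ps | Drop \<Rightarrow> insert u ps | Pick \<Rightarrow> ps - {u})
      (case a of Keep \<Rightarrow> k | Drop \<Rightarrow> k - 1 | Pick \<Rightarrow> k + 1)"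
    (is "_ \<leadsto> config_in s' u ?ps ?k")
proof -
  define d where "d = (SOME d. d \<in> - B u)"
  have ne: "- B u \<noteq> {}"
    using not_isolated[OF u] free_iff[OF u] by blast
  hence "d \<in> - B u"
    unfolding d_def by (metis some_in_eq)
  hence v: "neighbour u d \<in> V"
    using free_iff[OF u] by simp
  hence ret: "opposite d \<in> - B (neighbour u d)"
    using u by (simp add: free_iff)
  hence ne': "- B (neighbour u d) \<noteq> {}"
    by blast
  let ?C = "\<lparr>state = (s', Some (opposite d)), position = neighbour u d,
      pebbles = ?ps, carried = ?k\<rparr>"
  have "config_in s u ps k \<leadsto> ?C"
    by (rule reaches_step)
      (use ne e in \<open>simp add: step_def config_in_def program_automaton_def d_def Let_def
        split: pebble_action.split\<close>)
  also have "?C \<leadsto> config_in s' u ?ps ?k"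
    by (rule reaches_step)
      (use ne' ret in \<open>simp add: step_def config_in_def program_automaton_def free_or_def\<close>)
  finally show ?thesis .
qed

lemma walk_forward:
  assumes l: "prog ! l = Walk w s f"
    and "n \<le> length w" "\<forall>m\<le>n. foldl neighbour u (take m w) \<in> V"
  shows "at_line l u ps k \<leadsto> config_in (l, n, True) (foldl neighbour u (take n w)) ps k"
  using assms(2-)
proof (induction n)
  case 0
  then show ?case
    by (simp add: reaches_refl)
next
  case (Suc n)
  let ?v = "foldl neighbour u (take n w)"
  have next_node: "foldl neighbour u (take (Suc n) w) = neighbour ?v (w ! n)"
    using Suc.prems by (simp add: take_Suc_conv_app_nth)
  have "?v \<in> V" "neighbour ?v (w ! n) \<in> V"
    using Suc.prems next_node le_SucI by (metis order_refl)+
  moreover from this have "w ! n \<in> - B ?v"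
    by (simp add: free_iff)
  ultimately have *: "config_in (l, n, True) ?v ps k \<leadsto>
      config_in (l, Suc n, True) (neighbour ?v (w ! n)) ps k"
    using Suc.prems l by (intro exec_move) auto
  have "at_line l u ps k \<leadsto> config_in (l, n, True) ?v ps k"
    using Suc by simp
  from reaches_trans[OF this *] show ?case
    by (simp only: next_node)
qed

lemma walk_backward:
  assumes l: "prog ! l = Walk w s f"
    and "n \<le> length w" "\<forall>m\<le>n. foldl neighbour u (take m w) \<in> V"
  shows "config_in (l, n, False) (foldl neighbour u (take n w)) ps k \<leadsto>
    config_in (l, 0, False) u ps k"
  using assms(2-)
proof (induction n)
  case 0
  then show ?case
    by (simp add: reaches_refl)
next
  case (Suc n)
  let ?v = "foldl neighbour u (take n w)" and ?v' = "foldl neighbour u (take (Suc n) w)"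
  have next_node: "?v' = neighbour ?v (w ! n)"
    using Suc.prems by (simp add: take_Suc_conv_app_nth)
  have "?v \<in> V" "?v' \<in> V"
    using Suc.prems le_SucI by (metis order_refl)+
  hence "config_in (l, Suc n, False) ?v' ps k \<leadsto>
      config_in (l, n, False) (neighbour ?v' (opposite (w ! n))) ps k"
    using l next_node by (intro exec_move) auto
  also have "neighbour ?v' (opposite (w ! n)) = ?v"
    using next_node by simp
  also have "config_in (l, n, False) ?v ps k \<leadsto> config_in (l, 0, False) u ps k"
    using Suc by simp
  finally show ?case .
qed

lemma walk:
  assumes l: "prog ! l = Walk w s f" and u: "u \<in> V"
  shows "at_line l u ps k \<leadsto>
    (if stays_in V u w then at_line s (foldl neighbour u w) ps k else at_line f u ps k)"
proof (cases "stays_in V u w")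
  case True
  hence "\<forall>m\<le>length w. foldl neighbour u (take m w) \<in> V"
    by (simp add: stays_in_def)
  hence "at_line l u ps k \<leadsto> config_in (l, length w, True) (foldl neighbour u w) ps k"
    and v: "foldl neighbour u w \<in> V"
    using walk_forward[OF l, of "length w"] by auto
  note this(1)
  also have "config_in (l, length w, True) (foldl neighbour u w) ps k \<leadsto>
      at_line s (foldl neighbour u w) ps k"
    using exec_rest[of "(l, length w, True)" _ ps k "(s, 0, True)" Keep, OF _ v] l by simp
  finally show ?thesis
    using True by simp
next
  case False
  \<comment> \<open>The first position off \<open>V\<close>; the agent is stopped one letter
    earlier, at position \<open>n\<close>, and backtracks from there.\<close>
  define m where "m = (LEAST m. foldl neighbour u (take m w) \<notin> V)"
  obtain m0 where m0: "m0 \<le> length w" "foldl neighbour u (take m0 w) \<notin> V"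
    using False by (auto simp: stays_in_def)
  hence m: "foldl neighbour u (take m w) \<notin> V" "m \<le> length w"
    unfolding m_def by (metis (lifting) LeastI, metis (lifting) Least_le order_trans)
  with u obtain n where n: "m = Suc n"
    by (cases m) auto
  have inV: "foldl neighbour u (take j w) \<in> V" if "j \<le> n" for j
    using not_less_Least[of j "\<lambda>m. foldl neighbour u (take m w) \<notin> V"] that n
    by (auto simp: m_def)
  let ?v = "foldl neighbour u (take n w)"
  have "foldl neighbour u (take m w) = neighbour ?v (w ! n)"
    using m n by (simp add: take_Suc_conv_app_nth)
  hence blk: "w ! n \<notin> - B ?v"
    using m inV by (simp add: free_iff)
  have nlen: "n < length w"
    using m n by simp
  have "at_line l u ps k \<leadsto> config_in (l, n, True) ?v ps k"
    using walk_forward[OF l] nlen inV by simp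
  also have "\<dots> \<leadsto> config_in (l, n, False) ?v ps k"
    using exec_rest[of "(l, n, True)" ?v ps k "(l, n, False)" Keep] l nlen blk inV by simp
  also have "\<dots> \<leadsto> config_in (l, 0, False) u ps k"
    using walk_backward[OF l] nlen inV by simp
  also have "\<dots> \<leadsto> at_line f u ps k"
    using exec_rest[of "(l, 0, False)" u ps k "(f, 0, True)" Keep] l u by simp
  finally show ?thesis
    using False by simp
qed

lemma branch:
  assumes "prog ! l = Branch s f" "u \<in> V"
  shows "at_line l u ps k \<leadsto> at_line (if u \<in> ps then s else f) u ps k"
  using exec_rest[of "(l, 0, True)" u ps k "(if u \<in> ps then s else f, 0, True)" Keep] assms by simp

lemma put:
  assumes "prog ! l = Put s" "u \<in> V"
  shows "at_line l u {} 1 \<leadsto> at_line s u {u} 0"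
  using exec_rest[of "(l, 0, True)" u "{}" 1 "(s, 0, True)" Drop] assms by simp

lemma take:
  assumes "prog ! l = Take s" "u \<in> V"
  shows "at_line l u {u} 0 \<leadsto> at_line s u {} 1"
  using exec_rest[of "(l, 0, True)" u "{u}" 0 "(s, 0, True)" Pick] assms by simp

end

subsection \<open>The exploring program\<close>

definition shift :: "node \<Rightarrow> int \<Rightarrow> node \<Rightarrow> node" where
  "shift u n w = (fst u + n * fst w, snd u + n * snd w)"

lemma shift_0 [simp]: "shift u 0 w = u"
  by (simp add: shift_def)

lemma shift_shift [simp]: "shift (shift u m w) n w = shift u (m + n) w"
  by (simp add: shift_def algebra_simps)

lemma shift_uminus [simp]: "shift u n (- w) = shift u (- n) w"
  by (simp add: shift_def)

definition reverse_word :: "port list \<Rightarrow> port list" where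
  "reverse_word w = rev (map opposite w)"

lemma length_reverse_word [simp]: "length (reverse_word w) = length w"
  by (simp add: reverse_word_def)

lemma foldl_reverse_word [simp]:
  "foldl neighbour (foldl neighbour u w) (reverse_word w) = u"
  by (induction w arbitrary: u) (auto simp: reverse_word_def)

lemma foldl_take_reverse_word:
  "foldl neighbour (foldl neighbour u w) (take n (reverse_word w)) =
     foldl neighbour u (take (length w - n) w)"
proof -
  have "foldl neighbour u w =
      foldl neighbour (foldl neighbour u (take (length w - n) w)) (drop (length w - n) w)"
    by (metis append_take_drop_id foldl_append)
  moreover have "take n (reverse_word w) = reverse_word (drop (length w - n) w)"
    by (simp add: reverse_word_def take_rev drop_map)
  ultimately show ?thesis
    by simp
qed

text \<open>The reversed word visits the same nodes in the opposite order.\<close>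

lemma stays_in_reverse_word:
  assumes "stays_in V u w"
  shows "stays_in V (foldl neighbour u w) (reverse_word w)"
  using assms by (simp add: stays_in_def foldl_take_reverse_word)

lemma stays_in_end: "stays_in V u w \<Longrightarrow> foldl neighbour u w \<in> V"
  by (auto simp: stays_in_def)

definition reverse_words :: "port list \<times> port list \<Rightarrow> port list \<times> port list" where
  "reverse_words ws = (reverse_word (fst ws), reverse_word (snd ws))"

text \<open>
  In a union of two half-planes, one word keeps to the first half-plane whenever the target lies
  there, the other to the second.
\<close>

definition translation_words :: "node set \<Rightarrow> port list \<times> port list \<Rightarrow> node \<Rightarrow> bool" where
  "translation_words V ws w \<longleftrightarrow>
     (\<forall>u. foldl neighbour u (fst ws) = shift u 1 w \<and> foldl neighbour u (snd ws) = shift u 1 w \<and>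
       (u \<in> V \<longrightarrow> shift u 1 w \<in> V \<longrightarrow> stays_in V u (fst ws) \<or> stays_in V u (snd ws)))"

lemma translation_wordsD:
  assumes "translation_words V ws w"
  shows "foldl neighbour u (fst ws) = shift u 1 w" "foldl neighbour u (snd ws) = shift u 1 w"
    and "\<lbrakk>u \<in> V; shift u 1 w \<in> V\<rbrakk> \<Longrightarrow> stays_in V u (fst ws) \<or> stays_in V u (snd ws)"
  using assms unfolding translation_words_def by blast+

lemma translation_words_reverse:
  assumes "translation_words V ws w"
  shows "translation_words V (reverse_words ws) (- w)"
proof -
  note ends = translation_wordsD(1,2)[OF assms]
  have "foldl neighbour u (reverse_word (fst ws)) = shift u (-1) w"
       "foldl neighbour u (reverse_word (snd ws)) = shift u (-1) w" for u
    using foldl_reverse_word[of "shift u (-1) w" "fst ws"]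
      foldl_reverse_word[of "shift u (-1) w" "snd ws"] by (simp_all add: ends)
  moreover have "stays_in V u (reverse_word (fst ws)) \<or> stays_in V u (reverse_word (snd ws))"
    if "u \<in> V" "shift u (-1) w \<in> V" for u
  proof -
    have "stays_in V (shift u (-1) w) (fst ws) \<or> stays_in V (shift u (-1) w) (snd ws)"
      using translation_wordsD(3)[OF assms, of "shift u (-1) w"] that by simp
    thus ?thesis
      using stays_in_reverse_word[of V "shift u (-1) w" "fst ws"]
        stays_in_reverse_word[of V "shift u (-1) w" "snd ws"] by (auto simp: ends)
  qed
  ultimately show ?thesis
    by (simp add: translation_words_def reverse_words_def)
qed

text \<open>Among the translates of a node of \<open>V\<close> by integer multiples of
  \<open>w\<close>, those in \<open>V\<close> form a ray: advancing by \<open>w\<close> stops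
  eventually, retreating never does.\<close>

definition escape_direction :: "node set \<Rightarrow> node \<Rightarrow> bool" where
  "escape_direction V w \<longleftrightarrow>
     (\<forall>u\<in>V. shift u (-1) w \<in> V) \<and> (\<forall>u\<in>V. \<exists>n. shift u (int n) w \<notin> V)"

lemma escape_direction_prefix:
  assumes "escape_direction V w" "shift u (int n) w \<in> V" "m \<le> n"
  shows "shift u (int m) w \<in> V"
  using assms(3,2)
proof (induction rule: inc_induct)
  case (step m)
  then have "shift u (int (Suc m)) w \<in> V"
    by blast
  hence "shift (shift u (int (Suc m)) w) (-1) w \<in> V"
    using assms(1) by (simp only: escape_direction_def)
  thus ?case
    by simp
qed

text \<open>The trip begins on the pebble at line \<open>l\<close>; back on the pebble, the agent is at line \<open>l + 5\<close>.\<close>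

definition trip :: "nat \<Rightarrow> port list \<times> port list \<Rightarrow> instr list" where
  "trip l ws =
     [Walk (fst ws) l (l + 1), Walk (snd ws) l (l + 2), Branch (l + 5) (l + 3),
      Walk (fst (reverse_words ws)) (l + 2) (l + 4), Walk (snd (reverse_words ws)) (l + 2) 0]"

text \<open>The final failure target \<open>0\<close> is a dummy, because a retreat by the vector of
  \<open>wd\<close> never fails.\<close>

definition explorer ::
    "port list \<times> port list \<Rightarrow> port list \<times> port list \<Rightarrow> port list \<times> port list \<Rightarrow> instr list" where
  "explorer wd wv wv' =
     [Walk (fst wd) 0 1, Walk (snd wd) 0 2, Put 3] @ trip 3 wv @ trip 8 wv' @
     [Take 14, Walk (fst (reverse_words wd)) 2 15, Walk (snd (reverse_words wd)) 2 0]"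

lemma pebble_automaton_explorer:
  "pebble_automaton p (program_automaton (explorer wd wv wv'))"
  by (rule pebble_automaton_program) (auto simp: explorer_def trip_def)

section \<open>Advances and trips along a lattice vector\<close>

context walled_region
begin

text \<open>Both words end at the target, so neither can be completed if it is outside
  \<open>V\<close>. Otherwise one of them stays in \<open>V\<close>, and a failed first try ends
  back at \<open>u\<close>.\<close>

lemma attempt:
  assumes l: "prog ! l = Walk (fst ws) s l'" "prog ! l' = Walk (snd ws) s f"
    and ws: "translation_words V ws w" and u: "u \<in> V"
  shows "at_line l u ps k \<leadsto>
    (if shift u 1 w \<in> V then at_line s (shift u 1 w) ps k else at_line f u ps k)"
proof -
  note ends = translation_wordsD(1,2)[OF ws] and complete = translation_wordsD(3)[OF ws u]
  show ?thesis
  proof (cases "stays_in V u (fst ws)")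
    case True
    thus ?thesis
      using walk[OF l(1) u, of ps k] stays_in_end[OF True] by (simp add: ends)
  next
    case False
    hence "at_line l u ps k \<leadsto> at_line l' u ps k"
      using walk[OF l(1) u, of ps k] by simp
    also have "at_line l' u ps k \<leadsto>
        (if shift u 1 w \<in> V then at_line s (shift u 1 w) ps k else at_line f u ps k)"
      using walk[OF l(2) u, of ps k] stays_in_end[of V u "snd ws"] complete False
      by (auto simp: ends split: if_splits)
    finally show ?thesis .
  qed
qed

text \<open>Records the intermediate nodes of an advance, which are the nodes it explores;
  \<open>repeat_until_blocked\<close> yields only the last one.\<close>

lemma repeat:
  assumes l: "prog ! l = Walk (fst ws) l l'" "prog ! l' = Walk (snd ws) l f"
    and ws: "translation_words V ws w" and w: "escape_direction V w"
    and "shift u (int n) w \<in> V"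
  shows "at_line l u ps k \<leadsto> at_line l (shift u (int n) w) ps k"
  using assms(5)
proof (induction n)
  case 0
  then show ?case
    by (simp add: reaches_refl)
next
  case (Suc n)
  have v: "shift u (int n) w \<in> V"
    by (rule escape_direction_prefix[OF w Suc.prems]) simp
  have "at_line l u ps k \<leadsto> at_line l (shift u (int n) w) ps k"
    using Suc.IH v by blast
  also have "\<dots> \<leadsto> at_line l (shift u (int (Suc n)) w) ps k"
    using attempt[OF l ws v, of ps k] Suc.prems by (simp add: add.commute)
  finally show ?case .
qed

lemma repeat_until_blocked:
  assumes l: "prog ! l = Walk (fst ws) l l'" "prog ! l' = Walk (snd ws) l f"
    and ws: "translation_words V ws w" and w: "escape_direction V w" and u: "u \<in> V"
  obtains n where "shift u (int n) w \<in> V" "shift u (int n + 1) w \<notin> V"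
    "at_line l u ps k \<leadsto> at_line f (shift u (int n) w) ps k"
proof -
  define m where "m = (LEAST m. shift u (int m) w \<notin> V)"
  have m: "shift u (int m) w \<notin> V"
    unfolding m_def by (rule LeastI_ex) (use w u in \<open>simp add: escape_direction_def\<close>)
  with u obtain n where n: "m = Suc n"
    by (cases m) auto
  hence v: "shift u (int n) w \<in> V"
    using not_less_Least[of n "\<lambda>m. shift u (int m) w \<notin> V"] by (simp add: m_def)
  have nv: "shift u (int n + 1) w \<notin> V"
    using m n by (simp add: add.commute)
  have "at_line l u ps k \<leadsto> at_line l (shift u (int n) w) ps k"
    by (rule repeat[OF l ws w v])
  also have "\<dots> \<leadsto> at_line f (shift u (int n) w) ps k"
    using attempt[OF l ws v, of ps k] nv by simp
  finally show ?thesis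
    using that v nv by blast
qed

text \<open>The number of advances does not fit into a finite state, so \<open>Branch\<close>
  recognises the end of the way back by the pebble.\<close>

lemma trip:
  assumes l: "prog ! l = Walk (fst ws) l (l + 1)" "prog ! (l + 1) = Walk (snd ws) l (l + 2)"
      "prog ! (l + 2) = Branch (l + 5) (l + 3)"
      "prog ! (l + 3) = Walk (fst (reverse_words ws)) (l + 2) (l + 4)"
      "prog ! (l + 4) = Walk (snd (reverse_words ws)) (l + 2) 0"
    and ws: "translation_words V ws w" and w: "escape_direction V w" and P: "P \<in> V"
  shows "at_line l P {P} 0 \<leadsto> at_line (l + 5) P {P} 0"
proof -
  \<comment> \<open>Translation by zero would never leave \<open>V\<close>.\<close>
  have "w \<noteq> 0"
    using w P by (auto simp: escape_direction_def shift_def)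
  hence ne: "shift P (int (Suc n)) w \<noteq> P" for n
    by (cases P; cases w) (auto simp: shift_def zero_prod_def)
  have return: "at_line (l + 2) (shift P (int n) w) {P} 0 \<leadsto> at_line (l + 5) P {P} 0"
    if "shift P (int n) w \<in> V" for n
    using that
  proof (induction n)
    case 0
    then show ?case
      using branch[OF l(3), of P "{P}" 0] by simp
  next
    case (Suc n)
    let ?v = "shift P (int (Suc n)) w"
    have v: "shift P (int n) w \<in> V"
      by (rule escape_direction_prefix[OF w Suc.prems]) simp
    have "at_line (l + 2) ?v {P} 0 \<leadsto> at_line (l + 3) ?v {P} 0"
      using branch[OF l(3) Suc.prems, of "{P}" 0] ne[of n] by simp
    also have "\<dots> \<leadsto> at_line (l + 2) (shift P (int n) w) {P} 0"
      using attempt[OF l(4,5) translation_words_reverse[OF ws] Suc.prems, of "{P}" 0] v by simp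
    also have "\<dots> \<leadsto> at_line (l + 5) P {P} 0"
      using Suc.IH v by blast
    finally show ?case .
  qed
  obtain n where n: "shift P (int n) w \<in> V"
    and "at_line l P {P} 0 \<leadsto> at_line (l + 2) (shift P (int n) w) {P} 0"
    using repeat_until_blocked[OF l(1,2) ws w P] by metis
  note this(2)
  also have "\<dots> \<leadsto> at_line (l + 5) P {P} 0"
    by (rule return[OF n])
  finally show ?thesis .
qed

end

text \<open>In \<open>cover\<close>, \<open>P\<close> is the node where the initial advance by
  \<open>d\<close> stops, \<open>t\<close> counts the rounds before the one that visits
  \<open>x\<close>, and \<open>s\<close> counts the advances within that round.\<close>

locale explorable_region =
  walled_region V B prog
  for V B prog +
  fixes wd wv wv' :: "port list \<times> port list" and d v v' :: node
  assumes prog: "prog = explorer wd wv wv'"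
    and words: "translation_words V wd d" "translation_words V wv v" "translation_words V wv' v'"
    and escape: "escape_direction V d" "escape_direction V v" "escape_direction V v'"
    and cover: "\<lbrakk>P \<in> V; shift P 1 d \<notin> V; x \<in> V\<rbrakk> \<Longrightarrow>
      \<exists>s t. x = shift (shift P (- int t) d) (int s) v \<or> x = shift (shift P (- int t) d) (int s) v'"
begin

lemma prog_nth:
  "prog ! 0 = Walk (fst wd) 0 1"
  "prog ! 1 = Walk (snd wd) 0 2"
  "prog ! 2 = Put 3"
  "prog ! 13 = Take 14"
  "prog ! 14 = Walk (fst (reverse_words wd)) 2 15"
  "prog ! 15 = Walk (snd (reverse_words wd)) 2 0"
  "i < 5 \<Longrightarrow> prog ! (3 + i) = trip 3 wv ! i"
  "i < 5 \<Longrightarrow> prog ! (8 + i) = trip 8 wv' ! i"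
  by (auto simp: prog explorer_def trip_def nth_append less_Suc_eq numeral_eq_Suc)

lemma first_trip:
  assumes "P \<in> V"
  shows "at_line 3 P {P} 0 \<leadsto> at_line 8 P {P} 0"
    and "shift P (int s) v \<in> V \<Longrightarrow> at_line 3 P {P} 0 \<leadsto> at_line 3 (shift P (int s) v) {P} 0"
proof -
  note lines = prog_nth(7)[of 0] prog_nth(7)[of 1] prog_nth(7)[of 2]
    prog_nth(7)[of 3] prog_nth(7)[of 4]
  show "at_line 3 P {P} 0 \<leadsto> at_line 8 P {P} 0"
    using trip[of 3 wv, OF _ _ _ _ _ words(2) escape(2) assms] lines by (simp add: trip_def)
  show "at_line 3 P {P} 0 \<leadsto> at_line 3 (shift P (int s) v) {P} 0" if "shift P (int s) v \<in> V"
    using repeat[of 3 wv 4 5, OF _ _ words(2) escape(2) that] lines by (simp add: trip_def)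
qed

lemma second_trip:
  assumes "P \<in> V"
  shows "at_line 8 P {P} 0 \<leadsto> at_line 13 P {P} 0"
    and "shift P (int s) v' \<in> V \<Longrightarrow> at_line 8 P {P} 0 \<leadsto> at_line 8 (shift P (int s) v') {P} 0"
proof -
  note lines = prog_nth(8)[of 0] prog_nth(8)[of 1] prog_nth(8)[of 2]
    prog_nth(8)[of 3] prog_nth(8)[of 4]
  show "at_line 8 P {P} 0 \<leadsto> at_line 13 P {P} 0"
    using trip[of 8 wv', OF _ _ _ _ _ words(3) escape(3) assms] lines by (simp add: trip_def)
  show "at_line 8 P {P} 0 \<leadsto> at_line 8 (shift P (int s) v') {P} 0" if "shift P (int s) v' \<in> V"
    using repeat[of 8 wv' 9 10, OF _ _ words(3) escape(3) that] lines by (simp add: trip_def)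
qed

lemma round:
  assumes P: "P \<in> V"
  shows "at_line 2 P {} 1 \<leadsto> at_line 2 (shift P (-1) d) {} 1"
proof -
  have "at_line 2 P {} 1 \<leadsto> at_line 3 P {P} 0"
    by (rule put[OF prog_nth(3) P])
  also have "\<dots> \<leadsto> at_line 8 P {P} 0"
    by (rule first_trip[OF P])
  also have "\<dots> \<leadsto> at_line 13 P {P} 0"
    by (rule second_trip[OF P])
  also have "\<dots> \<leadsto> at_line 14 P {} 1"
    by (rule take[OF prog_nth(4) P])
  also have "\<dots> \<leadsto> at_line 2 (shift P (-1) d) {} 1"
    using attempt[OF prog_nth(5,6) translation_words_reverse[OF words(1)] P, of "{}" 1]
      escape(1) P by (simp add: escape_direction_def)
  finally show ?thesis .
qed

lemma rounds:
  assumes P: "P \<in> V"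
  shows "shift P (- int t) d \<in> V \<and> at_line 2 P {} 1 \<leadsto> at_line 2 (shift P (- int t) d) {} 1"
proof (induction t)
  case 0
  then show ?case
    using P by (simp add: reaches_refl)
next
  case (Suc t)
  let ?Q = "shift P (- int t) d"
  have eq: "shift ?Q (-1) d = shift P (- int (Suc t)) d"
    by (simp add: algebra_simps)
  have "shift ?Q (-1) d \<in> V" "at_line 2 ?Q {} 1 \<leadsto> at_line 2 (shift ?Q (-1) d) {} 1"
    using Suc round escape(1) by (auto simp only: escape_direction_def)
  thus ?case
    using Suc reaches_trans unfolding eq by blast
qed

lemma explores_region: "explores 1 (program_automaton prog) B V"
  unfolding explores_def
proof (intro ballI)
  fix u x assume u: "u \<in> V" and x: "x \<in> V"
  let ?A = "program_automaton prog"
  obtain n where P: "shift u (int n) d \<in> V" "shift u (int n + 1) d \<notin> V"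
    and init: "at_line 0 u {} 1 \<leadsto> at_line 2 (shift u (int n) d) {} 1"
    using repeat_until_blocked[OF prog_nth(1,2) words(1) escape(1) u] by metis
  define P where "P = shift u (int n) d"
  obtain s t where x_eq: "x = shift (shift P (- int t) d) (int s) v \<or>
      x = shift (shift P (- int t) d) (int s) v'"
    using cover[of P x] P x by (auto simp: P_def)
  let ?Q = "shift P (- int t) d"
  have Q: "?Q \<in> V" and "at_line 2 P {} 1 \<leadsto> at_line 2 ?Q {} 1"
    using rounds P by (auto simp: P_def simp del: shift_shift)
  note init
  also have "at_line 2 (shift u (int n) d) {} 1 \<leadsto> at_line 2 ?Q {} 1"
    using \<open>at_line 2 P {} 1 \<leadsto> at_line 2 ?Q {} 1\<close> by (simp only: P_def)
  also have "at_line 2 ?Q {} 1 \<leadsto> at_line 3 ?Q {?Q} 0"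
    by (rule put[OF prog_nth(3) Q])
  finally have start: "at_line 0 u {} 1 \<leadsto> at_line 3 ?Q {?Q} 0" .
  \<comment> \<open>The run is cut off in the middle of a trip, on arrival at \<open>x\<close>;
    \<open>l\<close> tells which of the two trips it is.\<close>
  have "\<exists>l. at_line 0 u {} 1 \<leadsto> at_line l x {?Q} 0"
    using x_eq
  proof
    assume eq: "x = shift ?Q (int s) v"
    note start
    also have "at_line 3 ?Q {?Q} 0 \<leadsto> at_line 3 x {?Q} 0"
      using first_trip(2)[OF Q] eq x by blast
    finally show ?thesis ..
  next
    assume eq: "x = shift ?Q (int s) v'"
    note start
    also have "at_line 3 ?Q {?Q} 0 \<leadsto> at_line 8 ?Q {?Q} 0"
      by (rule first_trip[OF Q])
    also have "at_line 8 ?Q {?Q} 0 \<leadsto> at_line 8 x {?Q} 0"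
      using second_trip(2)[OF Q] eq x by blast
    finally show ?thesis ..
  qed
  then obtain l n where "(step B ?A ^^ n) (at_line 0 u {} 1) = at_line l x {?Q} 0"
    by (auto simp only: reaches_def)
  moreover have "initial_config 1 ?A u = at_line 0 u {} 1"
    by (simp add: initial_config_def program_automaton_def config_in_def)
  ultimately have "position ((step B ?A ^^ n) (initial_config 1 ?A u)) = x"
    by (simp add: config_in_def)
  thus "\<exists>n. position ((step B ?A ^^ n) (initial_config 1 ?A u)) = x" ..
qed

end

subsection \<open>Unions of two half-planes\<close>

definition pairing :: "real \<times> real \<Rightarrow> node \<Rightarrow> real" where
  "pairing p u = fst p * of_int (fst u) + snd p * of_int (snd u)"

lemma pairing_shift [simp]: "pairing p (shift u n w) = pairing p u + of_int n * pairing p w"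
  by (simp add: pairing_def shift_def algebra_simps)

lemma foldl_replicate: "foldl neighbour u (replicate n d) = shift u (int n) (neighbour (0, 0) d)"
  by (induction n arbitrary: u; cases d) (auto simp: shift_def)

text \<open>Taking the less increasing of the two kinds of steps first keeps the maximum at the end.\<close>

lemma two_segment_word:
  assumes w: "\<And>u. shift (shift u (int k) e) (int k') e' = shift u 1 w"
    and e: "e = neighbour (0, 0) d" "e' = neighbour (0, 0) d'"
    and le: "pairing p e \<le> pairing p e'" and pos: "0 < pairing p w"
  shows "\<exists>ws. (\<forall>u. foldl neighbour u ws = shift u 1 w) \<and>
    (\<forall>u n. n \<le> length ws \<longrightarrow>
      pairing p (foldl neighbour u (take n ws)) \<le> pairing p (shift u 1 w))"
proof (intro exI[of _ "replicate k d @ replicate k' d'"] conjI allI impI)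
  show "foldl neighbour u (replicate k d @ replicate k' d') = shift u 1 w" for u
    using w by (simp add: foldl_replicate e)
next
  fix u n assume n: "n \<le> length (replicate k d @ replicate k' d')"
  have total: "pairing p w = real k * pairing p e + real k' * pairing p e'"
    using arg_cong[OF w[of "(0, 0)"], of "pairing p"] by (simp add: pairing_def[of p "(0, 0)"])
  \<comment> \<open>Otherwise both kinds of steps would decrease \<open>pairing p\<close>, contrary
    to \<open>pos\<close>.\<close>
  have e'0: "0 \<le> pairing p e'"
  proof (rule ccontr)
    assume "\<not> 0 \<le> pairing p e'"
    hence "real k * pairing p e \<le> 0" "real k' * pairing p e' \<le> 0"
      using le by (auto intro: mult_nonneg_nonpos)
    thus False
      using total pos by simp
  qed
  show "pairing p (foldl neighbour u (take n (replicate k d @ replicate k' d')))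
      \<le> pairing p (shift u 1 w)"
  proof (cases "n \<le> k")
    case True
    have "real n * pairing p e \<le> pairing p w"
    proof (cases "pairing p e \<le> 0")
      case True
      hence "real n * pairing p e \<le> 0"
        by (simp add: mult_nonneg_nonpos)
      thus ?thesis
        using pos by simp
    next
      case False
      hence "real n * pairing p e \<le> real k * pairing p e"
        using \<open>n \<le> k\<close> by (simp add: mult_right_mono)
      thus ?thesis
        using e'0 total by (simp add: add_increasing2)
    qed
    thus ?thesis
      using True by (simp add: foldl_replicate e min_def)
  next
    case False
    hence "real (n - k) * pairing p e' \<le> real k' * pairing p e'"
      using n e'0 by (intro mult_right_mono) auto
    thus ?thesis
      using False n total by (simp add: foldl_replicate e min_def)
  qed
qed

text \<open>A path with at most one corner: both orders of the horizontal and the vertical segment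
  end at the same node, so the order that \<open>two_segment_word\<close> requires can be
  chosen.\<close>

lemma monotone_word:
  assumes pos: "0 < pairing p w"
  shows "\<exists>ws. (\<forall>u. foldl neighbour u ws = shift u 1 w) \<and>
    (\<forall>u n. n \<le> length ws \<longrightarrow>
      pairing p (foldl neighbour u (take n ws)) \<le> pairing p (shift u 1 w))"
proof -
  define h where "h = (if 0 \<le> fst w then East else West)"
  define v where "v = (if 0 \<le> snd w then North else South)"
  let ?h = "neighbour (0, 0) h" and ?v = "neighbour (0, 0) v"
  let ?m = "nat \<bar>fst w\<bar>" and ?n = "nat \<bar>snd w\<bar>"
  have "shift (shift u (int ?m) ?h) (int ?n) ?v = shift u 1 w"
    "shift (shift u (int ?n) ?v) (int ?m) ?h = shift u 1 w" for u
    by (auto simp: shift_def h_def v_def)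
  note two = two_segment_word[OF this(1) refl refl _ pos] two_segment_word[OF this(2) refl refl _ pos]
  show ?thesis
    using two by (meson linorder_le_cases)
qed

locale two_half_planes =
  fixes p p' :: "real \<times> real" and b b' :: real and V :: "node set"
  assumes V_def: "V = {u. pairing p u \<le> b \<or> pairing p' u \<le> b'}"
begin

definition outward :: "node \<Rightarrow> bool" where
  "outward w \<longleftrightarrow> 0 < pairing p w \<and> 0 < pairing p' w"

text \<open>If the target lies in one of the half-planes, the word for its functional never exceeds
  the value at the target and so stays in that half-plane.\<close>

lemma outward_words:
  assumes "outward w"
  obtains ws where "translation_words V ws w"
proof -
  obtain ws where ws: "\<And>u. foldl neighbour u ws = shift u 1 w"
    "\<And>u n. n \<le> length ws \<Longrightarrow> pairing p (foldl neighbour u (take n ws)) \<le> pairing p (shift u 1 w)"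
    using monotone_word[of p w] assms unfolding outward_def by blast
  obtain ws' where ws': "\<And>u. foldl neighbour u ws' = shift u 1 w"
    "\<And>u n. n \<le> length ws' \<Longrightarrow> pairing p' (foldl neighbour u (take n ws')) \<le> pairing p' (shift u 1 w)"
    using monotone_word[of p' w] assms unfolding outward_def by blast
  have "stays_in V u ws \<or> stays_in V u ws'" if "shift u 1 w \<in> V" for u
    using that ws(2)[of _ u] ws'(2)[of _ u] unfolding stays_in_def V_def mem_Collect_eq
    by (meson order_trans)
  hence "translation_words V (ws, ws') w"
    by (simp add: translation_words_def ws ws')
  thus ?thesis
    by (rule that)
qed

lemma outward_escape:
  assumes "outward w"
  shows "escape_direction V w"
proof -
  have pos: "0 < pairing p w" "0 < pairing p' w"
    using assms by (auto simp: outward_def)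
  have "shift u (-1) w \<in> V" if "u \<in> V" for u
    using that pos by (auto simp: V_def)
  moreover have "\<exists>n. shift u (int n) w \<notin> V" for u
  proof -
    obtain m where m: "b - pairing p u < real m * pairing p w"
      using reals_Archimedean3[OF pos(1)] by blast
    obtain m' where m': "b' - pairing p' u < real m' * pairing p' w"
      using reals_Archimedean3[OF pos(2)] by blast
    \<comment> \<open>Leaving the union means exceeding both bounds, hence the maximum.\<close>
    have "real m * pairing p w \<le> real (max m m') * pairing p w"
      "real m' * pairing p' w \<le> real (max m m') * pairing p' w"
      using pos by (simp_all add: mult_right_mono)
    with m m' have "shift u (int (max m m')) w \<notin> V"
      by (simp add: V_def del: of_nat_max)
    thus ?thesis ..
  qed
  ultimately show ?thesis
    by (simp add: escape_direction_def)
qed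

text \<open>A step West or East does not increase the functional of a half-plane containing
  \<open>u\<close>.\<close>

lemma not_isolated:
  assumes "u \<in> V"
  shows "\<exists>d. neighbour u d \<in> V"
proof -
  have "\<exists>d. pairing q (neighbour u d) \<le> pairing q u" for q
  proof (cases "0 \<le> fst q")
    case True
    hence "pairing q (neighbour u West) \<le> pairing q u"
      by (cases u) (simp add: pairing_def algebra_simps)
    thus ?thesis ..
  next
    case False
    hence "pairing q (neighbour u East) \<le> pairing q u"
      by (cases u) (simp add: pairing_def algebra_simps)
    thus ?thesis ..
  qed
  with assms show ?thesis
    unfolding V_def mem_Collect_eq by (meson order_trans)
qed

text \<open>Rounding \<open>n\<close> times the real direction \<open>(r, s)\<close> down costs a
  bounded error, which a large \<open>n\<close> outweighs for both functionals. Division by the gcd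
  makes the vector primitive, so that it extends to a lattice basis.\<close>

lemma outward_lattice_vector:
  assumes "0 < fst p * r + snd p * s" "0 < fst p' * r + snd p' * s"
  obtains w where "outward w" "coprime (fst w) (snd w)"
proof -
  have approx: "0 < pairing q (\<lfloor>real n * r\<rfloor>, \<lfloor>real n * s\<rfloor>)"
    if n: "\<bar>fst q\<bar> + \<bar>snd q\<bar> < real n * (fst q * r + snd q * s)" for q n
  proof -
    have "\<bar>fst q * (real n * r - \<lfloor>real n * r\<rfloor>)\<bar> \<le> \<bar>fst q\<bar> * 1"
      "\<bar>snd q * (real n * s - \<lfloor>real n * s\<rfloor>)\<bar> \<le> \<bar>snd q\<bar> * 1"
      unfolding abs_mult by (intro mult_left_mono; linarith)+
    with n show ?thesis
      by (simp add: pairing_def algebra_simps)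
  qed
  obtain m where m: "\<bar>fst p\<bar> + \<bar>snd p\<bar> < real m * (fst p * r + snd p * s)"
    using reals_Archimedean3[OF assms(1)] by blast
  obtain m' where m': "\<bar>fst p'\<bar> + \<bar>snd p'\<bar> < real m' * (fst p' * r + snd p' * s)"
    using reals_Archimedean3[OF assms(2)] by blast
  define n where "n = max m m'"
  define w where "w = (\<lfloor>real n * r\<rfloor>, \<lfloor>real n * s\<rfloor>)"
  have "real m * (fst p * r + snd p * s) \<le> real n * (fst p * r + snd p * s)"
    "real m' * (fst p' * r + snd p' * s) \<le> real n * (fst p' * r + snd p' * s)"
    using assms by (simp_all add: n_def mult_right_mono)
  hence pos: "0 < pairing p w" "0 < pairing p' w"
    unfolding w_def using m m' by (intro approx; linarith)+
  define g where "g = gcd (fst w) (snd w)"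
  have "w \<noteq> (0, 0)"
    using pos by (auto simp: pairing_def)
  hence g: "g > 0"
    by (cases w) (auto simp: g_def)
  define w' where "w' = (fst w div g, snd w div g)"
  have w: "w = shift (0, 0) g w'"
    by (cases w) (simp add: shift_def w'_def g_def)
  have "pairing q w = of_int g * pairing q w'" for q
    by (subst w) (simp add: pairing_def[of q "(0, 0)"])
  hence "outward w'"
    using pos g by (simp add: outward_def zero_less_mult_iff)
  moreover have "coprime (fst w') (snd w')"
    using g by (simp add: w'_def g_def div_gcd_coprime)
  ultimately show ?thesis
    by (rule that)
qed

text \<open>Bezout extends the primitive \<open>d\<close> to a basis by \<open>a\<close>, and a
  large \<open>k\<close> makes \<open>k d + a\<close> and \<open>k d - a\<close> outward. In this
  basis, a node missed by both families is reached from \<open>P + d\<close> by outward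
  vectors.\<close>

lemma outward_cover:
  assumes "0 < fst p * r + snd p * s" "0 < fst p' * r + snd p' * s"
  obtains d v v' where "outward d" "outward v" "outward v'"
    "\<And>P x. \<lbrakk>shift P 1 d \<notin> V; x \<in> V\<rbrakk> \<Longrightarrow>
      \<exists>s t. x = shift (shift P (- int t) d) (int s) v \<or> x = shift (shift P (- int t) d) (int s) v'"
proof -
  obtain d where d: "outward d" "coprime (fst d) (snd d)"
    using outward_lattice_vector[OF assms] .
  obtain y z where "z * fst d + y * snd d = 1"
    using bezout_int[of "fst d" "snd d"] d(2) by (metis coprime_imp_gcd_eq_1)
  define a where "a = (- y, z)"
  have det: "fst d * snd a - snd d * fst a = 1"
    using \<open>z * fst d + y * snd d = 1\<close> by (simp add: a_def algebra_simps)
  have pos: "0 < pairing p d" "0 < pairing p' d"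
    using d(1) by (auto simp: outward_def)
  obtain m where m: "\<bar>pairing p a\<bar> < real m * pairing p d"
    using reals_Archimedean3[OF pos(1)] by blast
  obtain m' where m': "\<bar>pairing p' a\<bar> < real m' * pairing p' d"
    using reals_Archimedean3[OF pos(2)] by blast
  define k where "k = max m m'"
  have "real m * pairing p d \<le> real k * pairing p d" "real m' * pairing p' d \<le> real k * pairing p' d"
    using pos by (simp_all add: k_def mult_right_mono)
  with m m' have k: "\<bar>pairing p a\<bar> < real k * pairing p d" "\<bar>pairing p' a\<bar> < real k * pairing p' d"
    by linarith+
  define v where "v = shift a (int k) d"
  define v' where "v' = shift (- a) (int k) d"
  have neg: "pairing q (- a) = - pairing q a" for q
    by (simp add: pairing_def)
  have out: "outward v" "outward v'"
    using k by (auto simp: outward_def v_def v'_def neg)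
  have beyond: "shift (shift (shift P 1 d) (int i) w) (int j) d \<notin> V"
    if P: "shift P 1 d \<notin> V" and w: "outward w" for P i j w
  proof -
    have "0 \<le> real i * pairing p w" "0 \<le> real i * pairing p' w"
      "0 \<le> real j * pairing p d" "0 \<le> real j * pairing p' d"
      using pos w by (simp_all add: outward_def)
    thus ?thesis
      using P by (simp add: V_def)
  qed
  have "\<exists>s t. x = shift (shift P (- int t) d) (int s) v \<or> x = shift (shift P (- int t) d) (int s) v'"
    if P: "shift P 1 d \<notin> V" and x: "x \<in> V" for P x
  proof -
    define y where "y = x - P"
    \<comment> \<open>Cramer's rule for the coordinates of \<open>x - P\<close> in the basis
      \<open>a\<close>, \<open>d\<close>, whose determinant is 1 by \<open>det\<close>.\<close>
    define i where "i = fst d * snd y - snd d * fst y"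
    define j where "j = fst y * snd a - snd y * fst a"
    have "fst y * (fst d * snd a - snd d * fst a) = i * fst a + j * fst d"
      "snd y * (fst d * snd a - snd d * fst a) = i * snd a + j * snd d"
      by (simp_all add: i_def j_def algebra_simps)
    hence xij: "x = shift (shift P i a) j d"
      unfolding det by (cases x; cases P) (auto simp: y_def shift_def algebra_simps)
    define w where "w = (if 0 \<le> i then v else v')"
    define s where "s = nat \<bar>i\<bar>"
    \<comment> \<open>The \<open>s\<close> advances by \<open>w\<close> contribute
      \<open>s * k\<close> copies of \<open>d\<close>; \<open>l\<close> is the retreat along
      \<open>d\<close> that compensates for the surplus over \<open>j\<close>.\<close>
    define l where "l = int s * int k - j"
    have xsl: "x = shift (shift P (- l) d) (int s) w"
      by (cases "0 \<le> i") (auto simp: xij w_def v_def v'_def s_def l_def shift_def algebra_simps)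
    have "0 \<le> l"
    proof (rule ccontr)
      assume "\<not> 0 \<le> l"
      \<comment> \<open>One copy of \<open>d\<close> is split off, because it is
        \<open>P + d\<close> that is known to be outside \<open>V\<close>.\<close>
      hence "x = shift (shift (shift P 1 d) (int s) w) (int (nat (- l - 1))) d"
        by (subst xsl) (simp add: shift_def algebra_simps)
      moreover have "outward w"
        using out by (simp add: w_def)
      ultimately show False
        using beyond[OF P] x by metis
    qed
    then obtain t where "l = int t"
      using nonneg_int_cases by blast
    thus ?thesis
      using xsl by (metis w_def)
  qed
  with d(1) out show ?thesis
    by (rule that)
qed

text \<open>The vector \<open>(r, s)\<close> witnesses that the cone of outward directions is
  nonempty.\<close>

lemma explorable:
  assumes "0 < fst p * r + snd p * s" "0 < fst p' * r + snd p' * s"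
    and B: "\<And>u. B u = {d. u \<in> V \<longleftrightarrow> neighbour u d \<notin> V}"
  shows "\<exists>A :: nat automaton. pebble_automaton 1 A \<and> explores 1 A B V"
proof -
  obtain d v v' where out: "outward d" "outward v" "outward v'"
    and cover: "\<And>P x. \<lbrakk>shift P 1 d \<notin> V; x \<in> V\<rbrakk> \<Longrightarrow>
      \<exists>s t. x = shift (shift P (- int t) d) (int s) v \<or> x = shift (shift P (- int t) d) (int s) v'"
    using outward_cover[OF assms(1,2)] by metis
  obtain wd wv wv' where "translation_words V wd d" "translation_words V wv v"
    "translation_words V wv' v'"
    using outward_words out by metis
  then interpret explorable_region V B "explorer wd wv wv'" wd wv wv' d v v'
    using cover by unfold_locales
      (simp_all add: B not_isolated outward_escape out)
  show ?thesis
    using explores_region pebble_automaton_explorer explores_encode pebble_automaton_encode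
    by blast
qed

end

subsection \<open>Large wedges\<close>

locale large_wedge_angles =
  fixes \<theta>1 \<theta>2 :: real
  assumes large: "large_wedge \<theta>1 \<theta>2"
begin

text \<open>Signed distance from the line of the first half-line, relative to the apex and positive
  to its left. Likewise \<open>right\<close> is positive to the right of the second
  half-line.\<close>

definition left :: "complex \<Rightarrow> real" where
  "left z = Im (z * cis (- \<theta>1))"

definition right :: "complex \<Rightarrow> real" where
  "right z = - Im (z * cis (- \<theta>2))"

abbreviation \<alpha> :: real where
  "\<alpha> \<equiv> clockwise_angle \<theta>1 \<theta>2"

lemma angle: "pi \<le> \<alpha>" "\<alpha> < 2 * pi"
  using large by (auto simp: large_wedge_def clockwise_angle_def rmod_less)

lemma cis_1: "cis \<theta>1 = cis (\<theta>2 + \<alpha>)"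
proof -
  have "cis \<alpha> = cis (\<theta>1 - \<theta>2)"
    by (simp add: clockwise_angle_def)
  hence "cis (\<theta>2 + \<alpha>) = cis \<theta>2 * cis (\<theta>1 - \<theta>2)"
    by (metis cis_mult)
  thus ?thesis
    by (simp add: cis_mult)
qed

lemma left_polar: "left (of_real r * cis (\<theta>1 - \<phi>)) = - r * sin \<phi>"
  by (simp add: left_def mult.assoc cis_mult)

lemma right_polar: "right (of_real r * cis (\<theta>1 - \<phi>)) = - r * sin (\<alpha> - \<phi>)"
proof -
  have "cis (\<theta>1 - \<phi>) * cis (- \<theta>2) = cis \<theta>1 * cis (- \<phi> - \<theta>2)"
    by (simp add: cis_mult algebra_simps)
  also have "\<dots> = cis (\<alpha> - \<phi>)"
    by (simp add: cis_1 cis_mult)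
  finally show ?thesis
    by (simp add: right_def mult.assoc)
qed

text \<open>Conjugation turns the clockwise angle into the principal argument, which lies between 0
  and \<open>pi\<close> on the closed upper half-plane.\<close>

lemma polar_lower_half_plane:
  assumes "Im (z * cis (- \<theta>)) \<le> 0"
  obtains r \<phi> where "0 \<le> r" "0 \<le> \<phi>" "\<phi> \<le> pi" "z = of_real r * cis (\<theta> - \<phi>)"
proof -
  define w where "w = cnj (z * cis (- \<theta>))"
  have "0 \<le> Im w"
    using assms by (simp add: w_def)
  hence \<phi>: "0 \<le> Arg w" "Arg w \<le> pi"
    using Arg_less_0 Arg_bounded by auto
  have "w = of_real (cmod w) * cis (Arg w)"
    by (metis rcis_cmod_Arg rcis_def)
  hence "z * cis (- \<theta>) = of_real (cmod w) * cis (- Arg w)"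
    unfolding w_def by (metis cis_cnj complex_cnj_cnj complex_cnj_complex_of_real complex_cnj_mult)
  hence "z * cis (- \<theta>) * cis \<theta> = of_real (cmod w) * (cis (- Arg w) * cis \<theta>)"
    by (simp add: mult.assoc)
  hence "z = of_real (cmod w) * cis (\<theta> - Arg w)"
    by (simp add: mult.assoc cis_mult)
  with \<phi> show ?thesis
    by (intro that) auto
qed

text \<open>The two half-planes are the half-turn starting at the first half-line and the half-turn
  ending at the second. By \<open>angle\<close>, both fit into the sweep and together they cover
  it.\<close>

lemma swept_region_iff:
  "c + z \<in> swept_region c \<theta>1 \<theta>2 \<longleftrightarrow> left z \<le> 0 \<or> right z \<le> 0"
proof
  assume "c + z \<in> swept_region c \<theta>1 \<theta>2"
  then obtain \<phi> r where \<phi>: "0 \<le> \<phi>" "\<phi> \<le> \<alpha>" and r: "0 \<le> r"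
    and z: "z = of_real r * cis (\<theta>1 - \<phi>)"
    by (auto simp: swept_region_def half_line_def)
  show "left z \<le> 0 \<or> right z \<le> 0"
  proof (cases "\<phi> \<le> pi")
    case True
    hence "0 \<le> sin \<phi>"
      using \<phi> by (intro sin_ge_zero)
    thus ?thesis
      using r by (simp add: z left_polar)
  next
    case False
    hence "0 \<le> sin (\<alpha> - \<phi>)"
      using \<phi> angle by (intro sin_ge_zero) auto
    thus ?thesis
      using r by (simp add: z right_polar)
  qed
next
  have intro: "c + z \<in> swept_region c \<theta>1 \<theta>2"
    if "0 \<le> r" "0 \<le> \<phi>" "\<phi> \<le> \<alpha>" "z = of_real r * cis (\<theta>1 - \<phi>)" for r \<phi>
    using that by (force simp: swept_region_def half_line_def)
  assume "left z \<le> 0 \<or> right z \<le> 0"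
  thus "c + z \<in> swept_region c \<theta>1 \<theta>2"
  proof
    assume "left z \<le> 0"
    then obtain r \<phi> where "0 \<le> r" "0 \<le> \<phi>" "\<phi> \<le> pi" "z = of_real r * cis (\<theta>1 - \<phi>)"
      using polar_lower_half_plane[of z \<theta>1] by (auto simp: left_def)
    thus ?thesis
      using angle by (intro intro) auto
  next
    assume "right z \<le> 0"
    \<comment> \<open>Reflection in the real axis, so that \<phi> becomes the counterclockwise angle
      from the second half-line.\<close>
    hence "Im (cnj z * cis (- (- \<theta>2))) \<le> 0"
      by (simp add: right_def algebra_simps)
    then obtain r \<phi> where \<phi>: "0 \<le> r" "0 \<le> \<phi>" "\<phi> \<le> pi"
      and "cnj z = of_real r * cis (- \<theta>2 - \<phi>)"
      using polar_lower_half_plane by blast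
    hence "z = of_real r * cis (\<theta>2 + \<phi>)"
      by (metis cis_cnj complex_cnj_cnj complex_cnj_complex_of_real complex_cnj_mult
          minus_add_distrib diff_conv_add_uminus minus_minus)
    also have "cis (\<theta>2 + \<phi>) = cis \<theta>1 * cis (\<phi> - \<alpha>)"
      by (simp add: cis_1 cis_mult)
    also have "\<dots> = cis (\<theta>1 - (\<alpha> - \<phi>))"
      by (simp add: cis_mult algebra_simps)
    finally show ?thesis
      using \<phi> angle by (intro intro) auto
  qed
qed

text \<open>Only for \<open>\<alpha> = \<pi>\<close> can the negative parts of the boundary lines matter, and then they coincide
  with the other half-line.\<close>

lemma boundary_in_half_lines:
  assumes "left z = 0 \<and> 0 \<le> right z \<or> right z = 0 \<and> 0 \<le> left z"
  shows "c + z \<in> half_line c \<theta>1 \<or> c + z \<in> half_line c \<theta>2"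
proof -
  have half_line_intro: "c + of_real r * cis \<theta> \<in> half_line c \<theta>" if "0 \<le> r" for r \<theta>
    using that by (auto simp: half_line_def)
  have real_multiple: "z = of_real (Re (z * cis (- \<theta>))) * cis \<theta>" if "Im (z * cis (- \<theta>)) = 0" for \<theta>
  proof -
    have "of_real (Re (z * cis (- \<theta>))) = z * cis (- \<theta>)"
      using that by (simp add: complex_eq_iff)
    hence "of_real (Re (z * cis (- \<theta>))) * cis \<theta> = z * (cis (- \<theta>) * cis \<theta>)"
      by (simp only: mult.assoc)
    thus ?thesis
      by (simp add: cis_mult)
  qed
  \<comment> \<open>The sine is negative strictly between \<open>pi\<close> and
    \<open>2 * pi\<close>, so \<alpha> is \<open>pi\<close>. A negative multiple \<open>r\<close>
    below leads to this case.\<close>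
  have opposite_lines: "cis \<theta>1 = - cis \<theta>2" if "0 \<le> sin \<alpha>"
  proof -
    have "\<alpha> = pi"
      using that angle sin_lt_zero[of \<alpha>] by linarith
    thus ?thesis
      using cis_1 by (simp add: cis_mult[symmetric])
  qed
  show ?thesis
    using assms
  proof (elim disjE conjE)
    assume 0: "left z = 0" and nonneg: "0 \<le> right z"
    have "Im (z * cis (- \<theta>1)) = 0"
      using 0 by (simp only: left_def neg_equal_0_iff_equal)
    then obtain r where z: "z = of_real r * cis \<theta>1"
      using real_multiple by blast
    show ?thesis
    proof (cases "0 \<le> r")
      case False
      hence "0 \<le> sin \<alpha>"
        using nonneg right_polar[of r 0] by (simp add: z mult_le_0_iff)
      hence "z = of_real (- r) * cis \<theta>2"
        using opposite_lines z by simp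
      thus ?thesis
        using half_line_intro[of "- r" \<theta>2] False by simp
    qed (use half_line_intro z in blast)
  next
    assume 0: "right z = 0" and nonneg: "0 \<le> left z"
    have "Im (z * cis (- \<theta>2)) = 0"
      using 0 by (simp only: right_def neg_equal_0_iff_equal)
    then obtain r where z: "z = of_real r * cis \<theta>2"
      using real_multiple by blast
    show ?thesis
    proof (cases "0 \<le> r")
      case False
      have "cis \<theta>2 = cis (\<theta>1 - \<alpha>)"
        using cis_1 by (metis add_diff_cancel_right' cis_divide)
      hence "0 \<le> sin \<alpha>"
        using nonneg left_polar[of r \<alpha>] False by (simp add: z mult_le_0_iff)
      hence "z = of_real (- r) * cis \<theta>1"
        using opposite_lines z by simp
      thus ?thesis
        using half_line_intro[of "- r" \<theta>1] False by simp
    qed (use half_line_intro z in blast)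
  qed
qed

section \<open>Walls block every edge that leaves the wedge\<close>

lemma continuous_sides [continuous_intros]:
  assumes "continuous_on S f"
  shows "continuous_on S (\<lambda>x. left (f x))" "continuous_on S (\<lambda>x. right (f x))"
  unfolding left_def right_def by (intro continuous_intros assms)+

text \<open>The minimum of \<open>left\<close> and \<open>right\<close> is nonpositive exactly on
  the swept region. By the intermediate value theorem it vanishes somewhere on the segment, and its
  zeros are boundary points.\<close>

lemma segment_meets_half_line:
  assumes u: "u \<in> swept_region c \<theta>1 \<theta>2" and v: "v \<notin> swept_region c \<theta>1 \<theta>2"
  shows "half_line c \<theta>1 \<inter> closed_segment u v \<noteq> {} \<or> half_line c \<theta>2 \<inter> closed_segment u v \<noteq> {}"
proof -
  define h where "h t = min (left ((1 - t) *\<^sub>R u + t *\<^sub>R v - c)) (right ((1 - t) *\<^sub>R u + t *\<^sub>R v - c))"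
    for t :: real
  have "h 0 \<le> 0" "0 \<le> h 1"
    using swept_region_iff[of c "u - c"] swept_region_iff[of c "v - c"] u v
    by (auto simp: h_def min_def)
  moreover have "continuous_on {0..1} h"
    unfolding h_def by (intro continuous_intros)
  ultimately obtain t where t: "0 \<le> t" "t \<le> 1" "h t = 0"
    using IVT'[of h 0 0 1] by auto
  let ?w = "(1 - t) *\<^sub>R u + t *\<^sub>R v"
  have "left (?w - c) = 0 \<and> 0 \<le> right (?w - c) \<or> right (?w - c) = 0 \<and> 0 \<le> left (?w - c)"
    using t(3) by (auto simp: h_def min_def split: if_splits)
  hence "?w \<in> half_line c \<theta>1 \<or> ?w \<in> half_line c \<theta>2"
    using boundary_in_half_lines[of "?w - c" c] by simp
  moreover have "?w \<in> closed_segment u v"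
    using t(1,2) by (auto simp: closed_segment_def)
  ultimately show ?thesis
    by blast
qed

text \<open>The half-lines separate the wedge from its complement, so every edge leaving the wedge
  meets a wall.\<close>

lemma blocked_iff:
  "walled_wedge_blocked_ports c \<theta>1 \<theta>2 u =
     {d. u \<in> wedge c \<theta>1 \<theta>2 \<longleftrightarrow> neighbour u d \<notin> wedge c \<theta>1 \<theta>2}"
proof -
  have "half_line c \<theta>1 \<inter> closed_segment (point u) (point v) \<noteq> {} \<or>
      half_line c \<theta>2 \<inter> closed_segment (point u) (point v) \<noteq> {}"
    if "u \<in> wedge c \<theta>1 \<theta>2 \<longleftrightarrow> v \<notin> wedge c \<theta>1 \<theta>2" for v
    using that segment_meets_half_line[of "point u" c "point v"]
      segment_meets_half_line[of "point v" c "point u"]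
    by (auto simp: wedge_def closed_segment_commute)
  from this[of "neighbour u _"] show ?thesis
    by (auto simp: walled_wedge_blocked_ports_def blocked_ports_def Let_def)
qed

text \<open>The bounds are the values of the two functionals at the apex \<open>c\<close>.\<close>

lemma wedge_half_planes:
  "wedge c \<theta>1 \<theta>2 =
     {u. pairing (- sin \<theta>1, cos \<theta>1) u \<le> Im c * cos \<theta>1 - Re c * sin \<theta>1 \<or>
         pairing (sin \<theta>2, - cos \<theta>2) u \<le> Re c * sin \<theta>2 - Im c * cos \<theta>2}"
  using swept_region_iff[of c "point u - c" for u]
  by (simp add: wedge_def left_def right_def point_def pairing_def algebra_simps)

text \<open>The complement has the positive opening angle \<open>2 * pi\<close> - \<alpha>; turning
  the first half-line counterclockwise by half of it gives \<psi>.\<close>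

lemma bisector_of_complement:
  obtains \<psi> where "0 < left (cis \<psi>)" "0 < right (cis \<psi>)"
proof
  let ?\<phi> = "\<alpha> / 2 - pi"
  have pos: "0 < sin (\<alpha> / 2)"
    using angle pi_gt_zero by (intro sin_gt_zero) linarith+
  have "\<alpha> - ?\<phi> = \<alpha> / 2 + pi"
    by simp
  hence "sin ?\<phi> = - sin (\<alpha> / 2)" "sin (\<alpha> - ?\<phi>) = - sin (\<alpha> / 2)"
    by (simp_all only: sin_diff sin_add) simp_all
  thus "0 < left (cis (\<theta>1 - ?\<phi>))" "0 < right (cis (\<theta>1 - ?\<phi>))"
    using pos left_polar[of 1 ?\<phi>] right_polar[of 1 ?\<phi>] by simp_all
qed

end

theorem theorem6:
  fixes c :: complex and \<theta>1 \<theta>2 :: real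
  assumes "large_wedge \<theta>1 \<theta>2"
  shows "\<exists>A :: nat automaton. pebble_automaton 1 A \<and>
           explores 1 A (walled_wedge_blocked_ports c \<theta>1 \<theta>2) (wedge c \<theta>1 \<theta>2)"
proof -
  interpret large_wedge_angles \<theta>1 \<theta>2
    by unfold_locales (rule assms)
  interpret two_half_planes "(- sin \<theta>1, cos \<theta>1)" "(sin \<theta>2, - cos \<theta>2)"
    "Im c * cos \<theta>1 - Re c * sin \<theta>1" "Re c * sin \<theta>2 - Im c * cos \<theta>2" "wedge c \<theta>1 \<theta>2"
    by unfold_locales (rule wedge_half_planes)
  obtain \<psi> where "0 < left (cis \<psi>)" "0 < right (cis \<psi>)"
    by (rule bisector_of_complement)
  thus ?thesis
    by (intro explorable[of "cos \<psi>" "sin \<psi>"] blocked_iff)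
      (simp_all add: left_def right_def algebra_simps)
qed

end
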